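(* Let $\mathit{Var}$ be finite, $M$ a commutative complete quantale and $\sigma:\mathit{Var}\to M_1$. For every command $C$, $\mathcal A^C_M(1,\sigma)=\alpha^{\mathbb N}_\sigma\circ\Delta^{\mathbb N}_C$ pointwise. Consequently, for every $W\subseteq\mathit{Var}$, the greatest lower bound of $\{\bigotimes_{w\in W}\Gamma'(w)\mid 1\vdash_M\sigma\{C\}\Gamma'\text{ derivable}\}$ is $\alpha^{\mathbb N}_\sigma(\mathbb J^{\mathbb N}_W)$, where $\mathbb J^{\mathbb N}_W=\bigotimes_{w\in W}\Delta^{\mathbb N}_C(w)$.
   Context: Quantales. A commutative complete quantale $\langle M,\sqsubseteq,\bigvee,\otimes,1\rangle$ is a complete lattice with a commutative monoid $(\otimes,1)$ such that $\otimes$ distributes over arbitrary joins. $M_1=\{m\mid 1\sqsubseteq m\}$. $m^0=1$, $m^n$ is the $n$-fold tensor power, $m^*=\bigvee_{n\ge0}m^n$. Empty tensors are $1$. Multiset object. $\mathcal U_{\mathbb N}=\mathcal U_{\mathbb N}(\mathit{Var})$ is the set of downsets of $(\mathbb N^{\mathit{Var}},\le)$ ordered by inclusion, with $\bigvee=\bigcup$, $\mathbb M\otimes\mathbb N={\downarrow}\{m+n\mid m\in\mathbb M,n\in\mathbb N\}$, $1={\downarrow}0$; generators $\hat v={\downarrow}e_v$. For $\sigma:\mathit{Var}\to M_1$, $\alpha^{\mathbb N}_\sigma(\mathbb M)=\bigvee_{m\in\mathbb M}\bigotimes_v\sigma(v)^{m(v)}$. Language. Commands: $\mathsf{skip}$,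 $x:=E$, $C_1;C_2$, $\mathsf{if}\;E\;C_1\;C_2$, $\mathsf{while}\;E\;C$; $\mathit{fv}(E)$ is the set of variables of $E$, $\mathit{asgn}(C)$ the set of variables assigned in $C$. Typing rules (for each $M$). $\Gamma:\mathit{Var}\to M_1$, $p\in M_1$, $t_E(\Gamma)=\bigotimes_{v\in\mathit{fv}(E)}\Gamma(v)$. Derivability $p\vdash_M\Gamma\{C\}\Gamma'$ is generated by: (Skip) $p\vdash\Gamma\{\mathsf{skip}\}\Gamma$. (Assign) $p\vdash\Gamma\{x:=E\}\Gamma[x\mapsto p\otimes t_E(\Gamma)]$. (Seq) from $p\vdash\Gamma\{C_1\}\Gamma''$ and $p\vdash\Gamma''\{C_2\}\Gamma'$ infer $p\vdash\Gamma\{C_1;C_2\}\Gamma'$. (If) with $t=t_E(\Gamma)$, from $p\otimes t\vdash\Gamma\{C_i\}\Gamma_i'$ ($i=1,2$) infer $p\vdash\Gamma\{\mathsf{if}\;E\;C_1\;C_2\}\Gamma'$ where $\Gamma'(x)=t\otimes(\Gamma_1'(x)\vee\Gamma_2'(x))$ for $x\in\mathit{asgn}(C_1)\cup\mathit{asgn}(C_2)$ and $\Gamma'(x)=\Gamma(x)$ otherwise. (While) with $t=t_E(\Gamma)$, from $p\otimes t\vdash\Gamma\{C\}\Gamma$ infer $p\vdash\Gamma\{\mathsf{while}\;E\;C\}\Gamma^\dagger$ where $\Gamma^\dagger(x)=t^*\otimes\Gamma(x)$ for $x\in\mathit{asgn}(C)$ and $\Gamma^\dagger(x)=\Gamma(x)$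 otherwise. (Sub) from $p\vdash\Gamma\{C\}\Gamma_1'$, $p'\sqsubseteq p$, $\Gamma'\sqsubseteq\Gamma$, $\Gamma_1'\sqsubseteq\Gamma_2'$ infer $p'\vdash\Gamma'\{C\}\Gamma_2'$. Algorithmic system. $\mathcal A^C_M(p,\Gamma):\mathit{Var}\to M_1$ is defined by recursion on $C$: $\Gamma$ for $\mathsf{skip}$; $\Gamma[x\mapsto p\otimes t_E(\Gamma)]$ for $x:=E$; $\mathcal A^{C_2}(p,\mathcal A^{C_1}(p,\Gamma))$ for $C_1;C_2$; for $\mathsf{if}\;E\;C_1\;C_2$, with $t=t_E(\Gamma)$, $\Gamma_i'=\mathcal A^{C_i}(p\otimes t,\Gamma)$, the environment $x\mapsto t\otimes(\Gamma_1'(x)\vee\Gamma_2'(x))$ for $x\in\mathit{asgn}(C_1)\cup\mathit{asgn}(C_2)$ and $x\mapsto\Gamma(x)$ otherwise; for $\mathsf{while}\;E\;C$, with $\Gamma^*$ the least fixed point of $\Theta\mapsto\Gamma\vee\mathcal A^C(p\otimes t_E(\Theta),\Theta)$ and $t=t_E(\Gamma^* )$, the environment $x\mapsto t^*\otimes\Gamma^*(x)$ for $x\in\mathit{asgn}(C)$ and $x\mapsto\Gamma^*(x)$ otherwise. $\Delta^{\mathbb N}_C=\mathcal A^C_{\mathcal U_{\mathbb N}}(1,\Delta_0)$ with $\Delta_0(v)=\hat v$. *)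

theory Defs
  imports Main
begin

section \<open>Commutative complete quantales\<close>

class comm_quantale = complete_lattice + comm_monoid_mult +
  assumes mult_Sup_distrib: "a * Sup B = (SUP b\<in>B. a * b)"

definition M1 :: "'m::comm_quantale set" where
  "M1 = {m. 1 \<le> m}"

definition star :: "'m::comm_quantale \<Rightarrow> 'm" where
  "star m = (SUP n. m ^ n)"

lemma quantale_mult_mono:
  fixes a b c d :: "'m::comm_quantale"
  assumes "a \<le> b" "c \<le> d"
  shows "a * c \<le> b * d"
proof -
  have right: "x * y \<le> x * z" if "y \<le> z" for x y z :: 'm
  proof -
    have "x * z = x * Sup {y, z}"
      using that by (simp add: sup.absorb2)
    also have "\<dots> = (SUP b\<in>{y, z}. x * b)"
      by (rule mult_Sup_distrib)
    finally show ?thesis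
      by (metis SUP_upper insertI1)
  qed
  have "a * c \<le> a * d"
    using assms(2) by (rule right)
  also have "\<dots> \<le> b * d"
    using right[OF assms(1), of d] by (simp add: mult.commute)
  finally show ?thesis .
qed

lemma one_in_M1: "1 \<in> M1"
  by (simp add: M1_def)

lemma mult_in_M1: "a \<in> M1 \<Longrightarrow> b \<in> M1 \<Longrightarrow> a * b \<in> M1"
  using quantale_mult_mono[of 1 a 1 b] by (simp add: M1_def)

lemma prod_in_M1: "(\<And>x. x \<in> A \<Longrightarrow> f x \<in> M1) \<Longrightarrow> prod f A \<in> M1"
  by (induction A rule: infinite_finite_induct) (auto simp: one_in_M1 mult_in_M1)

lemma star_in_M1: "star m \<in> M1"
  unfolding M1_def star_def using SUP_upper[of 0 UNIV "\<lambda>n. m ^ n"] by simp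

lemma quantale_prod_mono:
  fixes f g :: "'a \<Rightarrow> 'm::comm_quantale"
  assumes "\<And>x. x \<in> A \<Longrightarrow> f x \<le> g x"
  shows "prod f A \<le> prod g A"
  using assms by (induction A rule: infinite_finite_induct) (auto intro: quantale_mult_mono)

lemma star_mono: "a \<le> b \<Longrightarrow> star a \<le> star b"
proof -
  assume "a \<le> b"
  then have "a ^ n \<le> b ^ n" for n
    by (induction n) (auto intro: quantale_mult_mono)
  then show ?thesis
    unfolding star_def by (intro SUP_mono) auto
qed

section \<open>The multiset object\<close>

definition down :: "('v \<Rightarrow> nat) set \<Rightarrow> ('v \<Rightarrow> nat) set" where
  "down A = {n. \<exists>m\<in>A. n \<le> m}"

typedef 'v multi = "{S :: ('v \<Rightarrow> nat) set. \<forall>m\<in>S. \<forall>n. n \<le> m \<longrightarrow> n \<in> S}"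
  morphisms msets Abs_multi
  by blast

setup_lifting type_definition_multi

lemma down_closed: "\<forall>m\<in>down A. \<forall>n. n \<le> m \<longrightarrow> n \<in> down A"
  unfolding down_def using order_trans by blast

lemma downset_down: "(\<forall>m\<in>S. \<forall>n. n \<le> m \<longrightarrow> n \<in> S) \<Longrightarrow> down S = S"
  unfolding down_def by auto

definition mset_plus :: "('v \<Rightarrow> nat) \<Rightarrow> ('v \<Rightarrow> nat) \<Rightarrow> 'v \<Rightarrow> nat" where
  "mset_plus m n = (\<lambda>v. m v + n v)"

lemma mset_plus_mono: "m \<le> m' \<Longrightarrow> n \<le> n' \<Longrightarrow> mset_plus m n \<le> mset_plus m' n'"
  by (auto simp: mset_plus_def le_fun_def add_mono)

definition set_plus :: "('v \<Rightarrow> nat) set \<Rightarrow> ('v \<Rightarrow> nat) set \<Rightarrow> ('v \<Rightarrow> nat) set" where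
  "set_plus S T = {mset_plus m n | m n. m \<in> S \<and> n \<in> T}"

lemma set_plusI: "x = mset_plus m n \<Longrightarrow> m \<in> S \<Longrightarrow> n \<in> T \<Longrightarrow> x \<in> set_plus S T"
  unfolding set_plus_def by blast

lemma set_plusE:
  assumes "x \<in> set_plus S T"
  obtains m n where "x = mset_plus m n" "m \<in> S" "n \<in> T"
  using assms unfolding set_plus_def by blast

lemma set_plus_commute: "set_plus S T = set_plus T S"
proof -
  have "set_plus S T \<subseteq> set_plus T S" for S T :: "('v \<Rightarrow> nat) set"
  proof
    fix x assume "x \<in> set_plus S T"
    then obtain m n where x: "x = mset_plus m n" and "m \<in> S" "n \<in> T"
      by (rule set_plusE)
    moreover have "x = mset_plus n m"
      unfolding x mset_plus_def by (simp add: add.commute)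
    ultimately show "x \<in> set_plus T S"
      by (intro set_plusI[of x n m])
  qed
  then show ?thesis
    by (intro equalityI)
qed

lemma set_plus_assoc: "set_plus (set_plus S T) U = set_plus S (set_plus T U)"
proof (intro equalityI subsetI)
  fix x assume "x \<in> set_plus (set_plus S T) U"
  then obtain s t u where x: "x = mset_plus (mset_plus s t) u" and "s \<in> S" "t \<in> T" "u \<in> U"
    by (elim set_plusE) simp
  moreover have "x = mset_plus s (mset_plus t u)"
    unfolding x mset_plus_def by (simp add: add.assoc)
  ultimately show "x \<in> set_plus S (set_plus T U)"
    by (intro set_plusI[of x s "mset_plus t u"] set_plusI[OF refl])
next
  fix x assume "x \<in> set_plus S (set_plus T U)"
  then obtain s t u where x: "x = mset_plus s (mset_plus t u)" and "s \<in> S" "t \<in> T" "u \<in> U"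
    by (elim set_plusE) simp
  moreover have "x = mset_plus (mset_plus s t) u"
    unfolding x mset_plus_def by (simp add: add.assoc)
  ultimately show "x \<in> set_plus (set_plus S T) U"
    by (intro set_plusI[of x "mset_plus s t" u] set_plusI[OF refl])
qed

lemma down_set_plus_down: "down (set_plus (down S) T) = down (set_plus S T)"
proof (intro set_eqI iffI)
  fix x assume "x \<in> down (set_plus (down S) T)"
  then obtain m s t where "x \<le> mset_plus m t" "m \<le> s" "s \<in> S" "t \<in> T"
    unfolding down_def set_plus_def by blast
  then have "x \<le> mset_plus s t" "mset_plus s t \<in> set_plus S T"
    using mset_plus_mono[of m s t t] unfolding set_plus_def
    by (auto intro: order_trans)
  then show "x \<in> down (set_plus S T)"
    unfolding down_def by blast
next
  fix x assume "x \<in> down (set_plus S T)"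
  then show "x \<in> down (set_plus (down S) T)"
    unfolding down_def set_plus_def by blast
qed

lemma set_plus_zero: "set_plus {\<lambda>_. 0} S = S"
  unfolding set_plus_def mset_plus_def by auto

instantiation multi :: (type) comm_quantale
begin

lift_definition less_eq_multi :: "'a multi \<Rightarrow> 'a multi \<Rightarrow> bool" is "(\<subseteq>)" .
lift_definition less_multi :: "'a multi \<Rightarrow> 'a multi \<Rightarrow> bool" is "(\<subset>)" .
lift_definition inf_multi :: "'a multi \<Rightarrow> 'a multi \<Rightarrow> 'a multi" is "(\<inter>)" by blast
lift_definition sup_multi :: "'a multi \<Rightarrow> 'a multi \<Rightarrow> 'a multi" is "(\<union>)" by blast
lift_definition bot_multi :: "'a multi" is "{}" by blast
lift_definition top_multi :: "'a multi" is "UNIV" by blast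
lift_definition Inf_multi :: "'a multi set \<Rightarrow> 'a multi" is "\<lambda>A. \<Inter>A" by blast
lift_definition Sup_multi :: "'a multi set \<Rightarrow> 'a multi" is "\<lambda>A. \<Union>A" by blast
lift_definition one_multi :: "'a multi" is "down {\<lambda>_. 0}" using down_closed by blast
lift_definition times_multi :: "'a multi \<Rightarrow> 'a multi \<Rightarrow> 'a multi"
  is "\<lambda>S T. down {(\<lambda>v. m v + n v) | m n. m \<in> S \<and> n \<in> T}" using down_closed by blast

lemma msets_times: "msets (S * T) = down (set_plus (msets S) (msets T))"
  by transfer (simp add: set_plus_def mset_plus_def)

lemma down_msets: "down (msets S) = msets S"
  using msets[of S] by (intro downset_down) blast

instance
proof
  fix a b c :: "'a multi" and B :: "'a multi set"
  have "msets (a * b * c) = down (set_plus (set_plus (msets a) (msets b)) (msets c))"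
    by (simp only: msets_times down_set_plus_down)
  also have "\<dots> = down (set_plus (set_plus (msets b) (msets c)) (msets a))"
    by (simp only: set_plus_assoc set_plus_commute[of "msets a"])
  also have "\<dots> = down (set_plus (msets (b * c)) (msets a))"
    by (simp only: msets_times down_set_plus_down)
  also have "\<dots> = msets (a * (b * c))"
    by (simp only: msets_times[of a] set_plus_commute[of "msets a"])
  finally show "a * b * c = a * (b * c)"
    by (simp only: msets_inject)
  show "a * b = b * a"
    by (simp only: msets_inject[symmetric] msets_times set_plus_commute[of "msets a"])
  show "1 * a = a"
    by (simp only: msets_inject[symmetric] msets_times one_multi.rep_eq down_set_plus_down
        set_plus_zero down_msets)
  have "set_plus (msets a) (\<Union>b\<in>B. msets b) = (\<Union>b\<in>B. set_plus (msets a) (msets b))"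
    unfolding set_plus_def by blast
  moreover have "down (\<Union>b\<in>B. f b) = (\<Union>b\<in>B. down (f b))" for f :: "'a multi \<Rightarrow> _"
    unfolding down_def by blast
  ultimately show "a * Sup B = (SUP b\<in>B. a * b)"
    by (simp only: msets_inject[symmetric] msets_times Sup_multi.rep_eq image_image)
qed (auto simp: less_eq_multi.rep_eq less_multi.rep_eq inf_multi.rep_eq sup_multi.rep_eq
      Inf_multi.rep_eq Sup_multi.rep_eq bot_multi.rep_eq top_multi.rep_eq msets_inject[symmetric])

end

lift_definition gen :: "'v \<Rightarrow> 'v multi"
  is "\<lambda>v. down {\<lambda>u. if u = v then 1 else 0}" using down_closed by blast

definition alpha :: "('v::finite \<Rightarrow> 'm::comm_quantale) \<Rightarrow> 'v multi \<Rightarrow> 'm" where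
  "alpha \<sigma> S = (SUP m\<in>msets S. \<Prod>v\<in>UNIV. \<sigma> v ^ m v)"

section \<open>Commands and the typing rules\<close>

text \<open>Expressions are left abstract: they form an arbitrary type \<open>'e\<close>, and what follows is
  parametric in the function \<open>fv\<close> giving the variables of an expression.\<close>

datatype ('v, 'e) com =
    Skip
  | Assign 'v 'e
  | Seq "('v, 'e) com" "('v, 'e) com"
  | Ite 'e "('v, 'e) com" "('v, 'e) com"
  | While 'e "('v, 'e) com"

primrec asgn :: "('v, 'e) com \<Rightarrow> 'v set" where
  "asgn Skip = {}"
| "asgn (Assign x E) = {x}"
| "asgn (Seq C1 C2) = asgn C1 \<union> asgn C2"
| "asgn (Ite E C1 C2) = asgn C1 \<union> asgn C2"
| "asgn (While E C) = asgn C"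

definition texp :: "('e \<Rightarrow> 'v::finite set) \<Rightarrow> 'e \<Rightarrow> ('v \<Rightarrow> 'm::comm_quantale) \<Rightarrow> 'm" where
  "texp fv E \<Gamma> = (\<Prod>v\<in>fv E. \<Gamma> v)"

text \<open>Environments into \<open>M1\<close> are functions with range in \<open>M1\<close>. The rules carry only those
  membership premises that do not follow from the others; see \<open>typing_M1\<close>.\<close>

inductive typing :: "('e \<Rightarrow> 'v::finite set) \<Rightarrow> 'm::comm_quantale \<Rightarrow> ('v \<Rightarrow> 'm) \<Rightarrow>
    ('v, 'e) com \<Rightarrow> ('v \<Rightarrow> 'm) \<Rightarrow> bool" for fv where
  T_Skip: "p \<in> M1 \<Longrightarrow> range \<Gamma> \<subseteq> M1 \<Longrightarrow> typing fv p \<Gamma> Skip \<Gamma>"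
| T_Assign: "p \<in> M1 \<Longrightarrow> range \<Gamma> \<subseteq> M1 \<Longrightarrow>
    typing fv p \<Gamma> (Assign x E) (\<Gamma>(x := p * texp fv E \<Gamma>))"
| T_Seq: "typing fv p \<Gamma> C1 \<Gamma>'' \<Longrightarrow> typing fv p \<Gamma>'' C2 \<Gamma>' \<Longrightarrow> typing fv p \<Gamma> (Seq C1 C2) \<Gamma>'"
| T_If: "p \<in> M1 \<Longrightarrow> t = texp fv E \<Gamma> \<Longrightarrow>
    typing fv (p * t) \<Gamma> C1 \<Gamma>1 \<Longrightarrow> typing fv (p * t) \<Gamma> C2 \<Gamma>2 \<Longrightarrow>
    typing fv p \<Gamma> (Ite E C1 C2)
      (\<lambda>x. if x \<in> asgn C1 \<union> asgn C2 then t * sup (\<Gamma>1 x) (\<Gamma>2 x) else \<Gamma> x)"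
| T_While: "p \<in> M1 \<Longrightarrow> t = texp fv E \<Gamma> \<Longrightarrow> typing fv (p * t) \<Gamma> C \<Gamma> \<Longrightarrow>
    typing fv p \<Gamma> (While E C) (\<lambda>x. if x \<in> asgn C then star t * \<Gamma> x else \<Gamma> x)"
| T_Sub: "p' \<in> M1 \<Longrightarrow> range \<Gamma>' \<subseteq> M1 \<Longrightarrow> typing fv p \<Gamma> C \<Gamma>1 \<Longrightarrow>
    p' \<le> p \<Longrightarrow> \<Gamma>' \<le> \<Gamma> \<Longrightarrow> \<Gamma>1 \<le> \<Gamma>2 \<Longrightarrow> typing fv p' \<Gamma>' C \<Gamma>2"

lemma texp_in_M1: "range \<Gamma> \<subseteq> M1 \<Longrightarrow> texp fv E \<Gamma> \<in> M1"
  unfolding texp_def by (rule prod_in_M1) auto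

lemma sup_in_M1: "a \<in> M1 \<Longrightarrow> sup a b \<in> M1"
  by (auto simp: M1_def intro: le_supI1)

lemma typing_M1:
  assumes "typing fv p \<Gamma> C \<Gamma>'"
  shows "p \<in> M1 \<and> range \<Gamma> \<subseteq> M1 \<and> range \<Gamma>' \<subseteq> M1"
  using assms
proof induction
  case (T_Sub p' \<Gamma>' p \<Gamma> C \<Gamma>1 \<Gamma>2)
  then show ?case
    by (auto simp: M1_def le_fun_def image_subset_iff intro: order_trans)
qed (auto simp: image_subset_iff intro!: mult_in_M1 texp_in_M1 star_in_M1 sup_in_M1)

section \<open>The algorithmic system\<close>

text \<open>The fixed point in the loop case is taken in the lattice of all functions into the quantale.
  If \<open>\<Gamma>\<close> has range in \<open>M1\<close> then so has every pre-fixed point, so it coincides with the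
  least fixed point among environments into \<open>M1\<close>; see \<open>loop_env_least\<close>.\<close>

primrec alg :: "('e \<Rightarrow> 'v::finite set) \<Rightarrow> ('v, 'e) com \<Rightarrow> 'm::comm_quantale \<Rightarrow>
    ('v \<Rightarrow> 'm) \<Rightarrow> 'v \<Rightarrow> 'm" where
  "alg fv Skip p \<Gamma> = \<Gamma>"
| "alg fv (Assign x E) p \<Gamma> = \<Gamma>(x := p * texp fv E \<Gamma>)"
| "alg fv (Seq C1 C2) p \<Gamma> = alg fv C2 p (alg fv C1 p \<Gamma>)"
| "alg fv (Ite E C1 C2) p \<Gamma> =
    (let t = texp fv E \<Gamma>; \<Gamma>1 = alg fv C1 (p * t) \<Gamma>; \<Gamma>2 = alg fv C2 (p * t) \<Gamma>
     in (\<lambda>x. if x \<in> asgn C1 \<union> asgn C2 then t * sup (\<Gamma>1 x) (\<Gamma>2 x) else \<Gamma> x))"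
| "alg fv (While E C) p \<Gamma> =
    (let \<Gamma>s = lfp (\<lambda>\<Theta>. sup \<Gamma> (alg fv C (p * texp fv E \<Theta>) \<Theta>)); t = texp fv E \<Gamma>s
     in (\<lambda>x. if x \<in> asgn C then star t * \<Gamma>s x else \<Gamma>s x))"

lemma texp_mono: "\<Gamma> \<le> \<Gamma>' \<Longrightarrow> texp fv E \<Gamma> \<le> texp fv E \<Gamma>'"
  unfolding texp_def by (rule quantale_prod_mono) (simp add: le_fun_def)

lemma alg_mono:
  fixes fv :: "'e \<Rightarrow> 'v::finite set" and p p' :: "'m::comm_quantale" and \<Gamma> \<Gamma>' :: "'v \<Rightarrow> 'm"
  shows "p \<le> p' \<Longrightarrow> \<Gamma> \<le> \<Gamma>' \<Longrightarrow> alg fv C p \<Gamma> \<le> alg fv C p' \<Gamma>'"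
proof (induction C arbitrary: p p' \<Gamma> \<Gamma>')
  case (Assign x E)
  then show ?case
    using quantale_mult_mono[OF Assign.prems(1) texp_mono[OF Assign.prems(2), of fv E]]
    by (auto simp: le_fun_def)
next
  case (Ite E C1 C2)
  note t = texp_mono[OF Ite.prems(2), of fv E]
  note pt = quantale_mult_mono[OF Ite.prems(1) t]
  note 1 = Ite.IH(1)[OF pt Ite.prems(2)]
  note 2 = Ite.IH(2)[OF pt Ite.prems(2)]
  show ?case
  proof (rule le_funI)
    fix x
    have "texp fv E \<Gamma> * sup (alg fv C1 (p * texp fv E \<Gamma>) \<Gamma> x) (alg fv C2 (p * texp fv E \<Gamma>) \<Gamma> x)
      \<le> texp fv E \<Gamma>' * sup (alg fv C1 (p' * texp fv E \<Gamma>') \<Gamma>' x) (alg fv C2 (p' * texp fv E \<Gamma>') \<Gamma>' x)"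
      by (rule quantale_mult_mono[OF t sup_mono[OF le_funD[OF 1] le_funD[OF 2]]])
    then show "alg fv (Ite E C1 C2) p \<Gamma> x \<le> alg fv (Ite E C1 C2) p' \<Gamma>' x"
      using le_funD[OF Ite.prems(2), of x] by (simp add: Let_def)
  qed
next
  case (While E C)
  define G where "G p \<Gamma> = lfp (\<lambda>\<Theta>. sup \<Gamma> (alg fv C (p * texp fv E \<Theta>) \<Theta>))"
    for p :: 'm and \<Gamma> :: "'v \<Rightarrow> 'm"
  have G: "G p \<Gamma> \<le> G p' \<Gamma>'"
    unfolding G_def
    by (rule lfp_mono, rule sup_mono[OF While.prems(2)], rule While.IH,
        rule quantale_mult_mono[OF While.prems(1) order_refl], rule order_refl)
  note t = texp_mono[OF G, of fv E]
  show ?case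
  proof (rule le_funI)
    fix x
    have "star (texp fv E (G p \<Gamma>)) * G p \<Gamma> x \<le> star (texp fv E (G p' \<Gamma>')) * G p' \<Gamma>' x"
      by (rule quantale_mult_mono[OF star_mono[OF t] le_funD[OF G]])
    then show "alg fv (While E C) p \<Gamma> x \<le> alg fv (While E C) p' \<Gamma>' x"
      using le_funD[OF G, of x] by (simp add: Let_def G_def[symmetric])
  qed
qed auto

lemma loop_env_least:
  fixes fv :: "'e \<Rightarrow> 'v::finite set" and \<Gamma> :: "'v \<Rightarrow> 'm::comm_quantale"
    and C :: "('v, 'e) com" and E :: 'e and p :: 'm
  assumes "range \<Gamma> \<subseteq> M1"
  defines "F \<equiv> \<lambda>\<Theta>. sup \<Gamma> (alg fv C (p * texp fv E \<Theta>) \<Theta>)"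
  shows "F (lfp F) = lfp F" and "range (lfp F) \<subseteq> M1"
    and "range \<Theta> \<subseteq> M1 \<Longrightarrow> F \<Theta> = \<Theta> \<Longrightarrow> lfp F \<le> \<Theta>"
proof -
  have "mono F"
    unfolding F_def
    by (rule monoI, rule sup_mono[OF order_refl], rule alg_mono,
        rule quantale_mult_mono[OF order_refl texp_mono])
  then show unfold: "F (lfp F) = lfp F"
    by (rule lfp_fixpoint)
  have "\<Gamma> \<le> F (lfp F)"
    unfolding F_def by (rule sup_ge1)
  then have "\<Gamma> \<le> lfp F"
    by (simp only: unfold)
  then show "range (lfp F) \<subseteq> M1"
    using assms(1) by (auto simp: M1_def le_fun_def image_subset_iff intro: order_trans)
  show "F \<Theta> = \<Theta> \<Longrightarrow> lfp F \<le> \<Theta>"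
    by (rule lfp_lowerbound) simp
qed

definition Delta :: "('e \<Rightarrow> 'v::finite set) \<Rightarrow> ('v, 'e) com \<Rightarrow> 'v \<Rightarrow> 'v multi" where
  "Delta fv C = alg fv C 1 gen"

definition J :: "('e \<Rightarrow> 'v::finite set) \<Rightarrow> ('v, 'e) com \<Rightarrow> 'v set \<Rightarrow> 'v multi" where
  "J fv C W = (\<Prod>w\<in>W. Delta fv C w)"

end

theory Submission
  imports Defs
begin

text \<open>Every map preserving joins, products and the unit commutes with the algorithmic system; for
  loops this is fixed point fusion. Evaluation \<open>alpha \<sigma>\<close> is such a map, and it sends the
  generator of \<open>v\<close> to \<open>\<sigma> v\<close>, because the values of \<open>\<sigma>\<close> lie above the unit. The second
  claim follows as the algorithmic environment is the least derivable one.\<close>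

lemma mono_loop: "mono (\<lambda>\<Theta>. sup \<Gamma> (alg fv C (p * texp fv E \<Theta>) \<Theta>))"
  by (intro monoI sup_mono order_refl alg_mono quantale_mult_mono texp_mono)

text \<open>Preservation of arbitrary joins, the empty one included, is what carries least fixed
  points along in \<open>hom_lfp\<close>.\<close>

locale quantale_hom =
  fixes h :: "'a::comm_quantale \<Rightarrow> 'b::comm_quantale"
  assumes hom_Sup: "h (Sup A) = Sup (h ` A)"
    and hom_mult: "h (a * b) = h a * h b"
    and hom_one: "h 1 = 1"
begin

lemma hom_sup: "h (sup a b) = sup (h a) (h b)"
  using hom_Sup[of "{a, b}"] by simp

lemma hom_power: "h (a ^ n) = h a ^ n"
  by (induction n) (simp_all add: hom_mult hom_one)

lemma hom_prod: "h (prod f A) = (\<Prod>x\<in>A. h (f x))"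
  \<comment> \<open>Over an infinite set both products are 1 by convention, so
    \<open>hom_one\<close> covers that case.\<close>
  by (induction A rule: infinite_finite_induct) (simp_all add: hom_mult hom_one)

lemma hom_star: "h (star a) = star (h a)"
  by (simp add: star_def hom_Sup image_image hom_power)

lemma hom_texp: "h (texp fv E \<Gamma>) = texp fv E (h \<circ> \<Gamma>)"
  by (simp add: texp_def hom_prod)

lemma hom_fun_Sup: "h \<circ> Sup A = Sup ((\<lambda>\<Gamma>. h \<circ> \<Gamma>) ` A)"
  by (rule ext) (simp add: hom_Sup image_image)

text \<open>Fixed point fusion: \<open>lfp F\<close> is built from below by steps of
  \<open>F\<close> and joins, and \<open>h\<close> turns these into steps of \<open>G\<close> and
  joins. Conversely, the image of \<open>lfp F\<close> is itself a fixed point of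
  \<open>G\<close>.\<close>

lemma hom_lfp:
  assumes "mono F" "mono G" and fusion: "\<And>\<Theta>. h \<circ> F \<Theta> = G (h \<circ> \<Theta>)"
  shows "h \<circ> lfp F = lfp G"
proof (rule antisym)
  show "h \<circ> lfp F \<le> lfp G"
  \<comment> \<open>The induction is transfinite because \<open>F\<close> is only assumed monotone,
    not continuous.\<close>
  proof (induction rule: lfp_ordinal_induct[OF \<open>mono F\<close>])
    case (1 \<Theta>)
    then have "G (h \<circ> \<Theta>) \<le> G (lfp G)"
      using \<open>mono G\<close> by (blast dest: monoD)
    then show ?case
      by (simp only: fusion lfp_fixpoint[OF \<open>mono G\<close>])
  next
    case (2 A)
    then show ?case
      by (auto simp only: hom_fun_Sup intro: SUP_least)
  qed
  have "G (h \<circ> lfp F) = h \<circ> lfp F"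
    by (simp only: fusion[symmetric] lfp_fixpoint[OF \<open>mono F\<close>])
  then show "lfp G \<le> h \<circ> lfp F"
    by (intro lfp_lowerbound) simp
qed

text \<open>Every clause of \<open>alg\<close> is built from products, binary joins,
  \<open>star\<close> and least fixed points, all of which \<open>h\<close> preserves.\<close>

lemma hom_alg: "h \<circ> alg fv C p \<Gamma> = alg fv C (h p) (h \<circ> \<Gamma>)"
proof (induction C arbitrary: p \<Gamma>)
  case (Assign x E)
  show ?case
    by (rule ext) (simp add: hom_mult hom_texp[unfolded comp_def])
next
  case (Seq C1 C2)
  then show ?case by simp
next
  case (Ite E C1 C2)
  have "h (alg fv C1 (p * texp fv E \<Gamma>) \<Gamma> x) = alg fv C1 (h p * texp fv E (h \<circ> \<Gamma>)) (h \<circ> \<Gamma>) x"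
    and "h (alg fv C2 (p * texp fv E \<Gamma>) \<Gamma> x) = alg fv C2 (h p * texp fv E (h \<circ> \<Gamma>)) (h \<circ> \<Gamma>) x" for x
    using Ite[of "p * texp fv E \<Gamma>" \<Gamma>, THEN fun_cong, of x]
    by (simp_all only: comp_def hom_mult hom_texp)
  then show ?case
    by (auto simp: Let_def fun_eq_iff hom_mult hom_sup hom_texp[unfolded comp_def] comp_def)
next
  case (While E C)
  let ?L = "lfp (\<lambda>\<Theta>. sup \<Gamma> (alg fv C (p * texp fv E \<Theta>) \<Theta>))"
  let ?L' = "lfp (\<lambda>\<Theta>. sup (h \<circ> \<Gamma>) (alg fv C (h p * texp fv E \<Theta>) \<Theta>))"
  \<comment> \<open>Fusion applies since, by the induction hypothesis, \<open>h\<close> intertwines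
    the two loop operators at every \<open>\<Theta>\<close>.\<close>
  have "h \<circ> ?L = ?L'"
  proof (rule hom_lfp[OF mono_loop mono_loop])
    fix \<Theta>
    have "h \<circ> sup \<Gamma> (alg fv C (p * texp fv E \<Theta>) \<Theta>)
        = sup (h \<circ> \<Gamma>) (h \<circ> alg fv C (p * texp fv E \<Theta>) \<Theta>)"
      by (rule ext) (simp add: hom_sup)
    then show "h \<circ> sup \<Gamma> (alg fv C (p * texp fv E \<Theta>) \<Theta>)
        = sup (h \<circ> \<Gamma>) (alg fv C (h p * texp fv E (h \<circ> \<Theta>)) (h \<circ> \<Theta>))"
      by (simp only: While hom_mult hom_texp)
  qed
  then have "h (texp fv E ?L) = texp fv E ?L'" "h (?L x) = ?L' x" for x
    by (simp only: hom_texp, metis comp_apply)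
  then show ?case
    by (auto simp: Let_def fun_eq_iff hom_mult hom_star comp_def)
qed simp

end

text \<open>The monomial with exponents \<open>m\<close>, evaluated at
  \<open>\<sigma>\<close>.\<close>

definition mon :: "('v::finite \<Rightarrow> 'm::comm_quantale) \<Rightarrow> ('v \<Rightarrow> nat) \<Rightarrow> 'm" where
  "mon \<sigma> m = (\<Prod>v\<in>UNIV. \<sigma> v ^ m v)"

lemma mon_zero: "mon \<sigma> (\<lambda>_. 0) = 1"
  by (simp add: mon_def)

lemma mon_plus: "mon \<sigma> (mset_plus m n) = mon \<sigma> m * mon \<sigma> n"
  by (simp add: mon_def mset_plus_def power_add prod.distrib)

lemma mon_unit: "mon \<sigma> (\<lambda>u. if u = v then 1 else 0) = \<sigma> v"
proof -
  have "mon \<sigma> (\<lambda>u. if u = v then 1 else 0) = (\<Prod>u\<in>UNIV. if u = v then \<sigma> u else 1)"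
    unfolding mon_def by (intro prod.cong) auto
  then show ?thesis by simp
qed

lemma power_in_M1: "a \<in> M1 \<Longrightarrow> a ^ n \<in> M1"
  by (induction n) (simp_all add: one_in_M1 mult_in_M1)

lemma mon_mono:
  assumes "range \<sigma> \<subseteq> M1" "m \<le> n"
  shows "mon \<sigma> m \<le> mon \<sigma> n"
proof -
  \<comment> \<open>Truncated subtraction is exact here because \<open>m \<le> n\<close>; the
    monomial of the difference lies above the unit.\<close>
  have n: "n = mset_plus m (\<lambda>v. n v - m v)"
    using assms(2) by (auto simp: mset_plus_def le_fun_def)
  have "1 \<le> mon \<sigma> k" for k
    using prod_in_M1[of UNIV "\<lambda>v. \<sigma> v ^ k v"] power_in_M1[of "\<sigma> _"] assms(1)
    unfolding mon_def M1_def by blast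
  then have "mon \<sigma> m * 1 \<le> mon \<sigma> m * mon \<sigma> (\<lambda>v. n v - m v)"
    by (intro quantale_mult_mono order_refl)
  then show ?thesis
    by (subst n) (simp only: mon_plus mult_1_right)
qed

lemma alpha_mon: "alpha \<sigma> S = (SUP m\<in>msets S. mon \<sigma> m)"
  by (simp add: alpha_def mon_def)

text \<open>Downward closure only adds exponents whose monomials lie below ones already present.
  This removes the \<open>down\<close> in the unit, products and generators of
  \<open>multi\<close>.\<close>

lemma SUP_mon_down:
  assumes "range \<sigma> \<subseteq> M1"
  shows "(SUP m\<in>down A. mon \<sigma> m) = (SUP m\<in>A. mon \<sigma> m)"
proof (rule antisym)
  show "(SUP m\<in>down A. mon \<sigma> m) \<le> (SUP m\<in>A. mon \<sigma> m)"
    by (rule SUP_mono) (auto simp: down_def intro: mon_mono[OF assms])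
  show "(SUP m\<in>A. mon \<sigma> m) \<le> (SUP m\<in>down A. mon \<sigma> m)"
    by (rule SUP_subset_mono) (auto simp: down_def)
qed

lemma SUP_mon_set_plus:
  "(SUP m\<in>set_plus A B. mon \<sigma> m) = (SUP m\<in>A. mon \<sigma> m) * (SUP m\<in>B. mon \<sigma> m)"
proof -
  have "(SUP m\<in>A. mon \<sigma> m) * (SUP n\<in>B. mon \<sigma> n) = (SUP n\<in>B. SUP m\<in>A. mon \<sigma> m * mon \<sigma> n)"
    \<comment> \<open>Distributivity acts on the right factor only, so the join over
      \<open>A\<close> is commuted there first; the second pass realigns the factors.\<close>
    by (simp only: mult_Sup_distrib image_image mult.commute[of "Sup (mon \<sigma> ` A)"])
      (simp only: mult.commute)
  also have "\<dots> = (SUP m\<in>(\<Union>n\<in>B. (\<lambda>m. mset_plus m n) ` A). mon \<sigma> m)"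
    by (simp add: SUP_UNION image_image mon_plus)
  also have "(\<Union>n\<in>B. (\<lambda>m. mset_plus m n) ` A) = set_plus A B"
    by (auto simp: set_plus_def)
  finally show ?thesis ..
qed

lemma quantale_hom_alpha:
  assumes "range \<sigma> \<subseteq> M1"
  shows "quantale_hom (alpha \<sigma>)"
proof
  show "alpha \<sigma> (Sup A) = Sup (alpha \<sigma> ` A)" for A
    by (simp add: alpha_mon Sup_multi.rep_eq SUP_UNION)
  show "alpha \<sigma> (S * T) = alpha \<sigma> S * alpha \<sigma> T" for S T
    by (simp add: alpha_mon msets_times SUP_mon_down[OF assms] SUP_mon_set_plus)
  show "alpha \<sigma> 1 = 1"
    by (simp add: alpha_mon one_multi.rep_eq SUP_mon_down[OF assms] mon_zero)
qed

lemma alpha_gen: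
  assumes "range \<sigma> \<subseteq> M1"
  shows "alpha \<sigma> \<circ> gen = \<sigma>"
  by (rule ext) (simp add: alpha_mon gen.rep_eq SUP_mon_down[OF assms] mon_unit)

lemma typing_alg:
  assumes "p \<in> M1" "range \<Gamma> \<subseteq> M1"
  shows "typing fv p \<Gamma> C (alg fv C p \<Gamma>)"
  using assms
proof (induction C arbitrary: p \<Gamma>)
  case Skip
  then show ?case by (simp add: T_Skip)
next
  case (Assign x E)
  then show ?case using T_Assign[OF Assign] by (simp only: alg.simps)
next
  case (Seq C1 C2)
  have 1: "typing fv p \<Gamma> C1 (alg fv C1 p \<Gamma>)"
    by (rule Seq.IH(1)[OF Seq.prems])
  then have "typing fv p (alg fv C1 p \<Gamma>) C2 (alg fv C2 p (alg fv C1 p \<Gamma>))"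
    by (intro Seq.IH(2)[OF Seq.prems(1)]) (simp add: typing_M1)
  with 1 show ?case by (simp add: T_Seq)
next
  case (Ite E C1 C2)
  have "p * texp fv E \<Gamma> \<in> M1"
    using Ite.prems by (intro mult_in_M1 texp_in_M1)
  then show ?case
    using T_If[OF Ite.prems(1) refl Ite.IH(1) Ite.IH(2)] Ite.prems(2) by (simp add: Let_def)
next
  case (While E C)
  define L where "L = lfp (\<lambda>\<Theta>. sup \<Gamma> (alg fv C (p * texp fv E \<Theta>) \<Theta>))"
  have fixp: "sup \<Gamma> (alg fv C (p * texp fv E L) L) = L"
    unfolding L_def by (rule loop_env_least(1)[OF While.prems(2)])
  have L: "range L \<subseteq> M1"
    unfolding L_def by (rule loop_env_least(2)[OF While.prems(2)])
  have pt: "p * texp fv E L \<in> M1"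
    using While.prems(1) L by (intro mult_in_M1 texp_in_M1)
  \<comment> \<open>The second inequality makes \<open>L\<close> a loop invariant once the
    postcondition is weakened.\<close>
  have "\<Gamma> \<le> L" "alg fv C (p * texp fv E L) L \<le> L"
    using fixp sup_ge1 sup_ge2 by metis+
  then have "typing fv (p * texp fv E L) L C L"
    using T_Sub[OF pt L While.IH[OF pt L] order_refl order_refl] by blast
  \<comment> \<open>\<open>T_While\<close> needs an invariant as its initial environment, so it is
    used at \<open>L\<close>, and subsumption lowers that environment to
    \<open>\<Gamma>\<close>.\<close>
  from T_Sub[OF While.prems T_While[OF While.prems(1) refl this] order_refl \<open>\<Gamma> \<le> L\<close> order_refl]
  show ?case
    by (simp add: Let_def flip: L_def)
qed

lemma alg_least:
  assumes "typing fv p \<Gamma> C \<Gamma>'"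
  shows "alg fv C p \<Gamma> \<le> \<Gamma>'"
  using assms
proof induction
  case (T_Seq p \<Gamma> C1 \<Gamma>'' C2 \<Gamma>')
  then show ?case
    using alg_mono[OF order_refl, of "alg fv C1 p \<Gamma>" \<Gamma>'' fv C2 p] by auto
next
  case (T_If p t E \<Gamma> C1 \<Gamma>1 C2 \<Gamma>2)
  then show ?case
    by (simp add: Let_def le_fun_def quantale_mult_mono sup_mono del: sup.bounded_iff)
next
  case (T_While p t E \<Gamma> C)
  define L where "L = lfp (\<lambda>\<Theta>. sup \<Gamma> (alg fv C (p * texp fv E \<Theta>) \<Theta>))"
  \<comment> \<open>By the induction hypothesis the invariant \<open>\<Gamma>\<close> is a pre-fixed
    point of the loop operator.\<close>
  have "L \<le> \<Gamma>"
    unfolding L_def using T_While by (intro lfp_lowerbound) simp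
  moreover from this have "star (texp fv E L) \<le> star t"
    using T_While.hyps(2) by (auto intro: star_mono texp_mono)
  ultimately show ?case
    by (auto simp: Let_def le_fun_def simp flip: L_def intro!: quantale_mult_mono)
next
  case (T_Sub p' \<Gamma>' p \<Gamma> C \<Gamma>1 \<Gamma>2)
  then show ?case
    using alg_mono[of p' p \<Gamma>' \<Gamma> fv C] by (meson order_trans)
qed simp_all

text \<open>The infimum is attained: \<open>alg\<close> yields a derivable environment below all
  others, and products are monotone.\<close>

lemma Inf_typing_prod:
  assumes "p \<in> M1" "range \<Gamma> \<subseteq> M1"
  shows "Inf {(\<Prod>w\<in>W. \<Gamma>' w) | \<Gamma>'. typing fv p \<Gamma> C \<Gamma>'} = (\<Prod>w\<in>W. alg fv C p \<Gamma> w)"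
  by (rule Inf_eqI)
    (auto intro: quantale_prod_mono dest: alg_least le_funD, use typing_alg[OF assms] in blast)

theorem theorem3:
  fixes fv :: "'e \<Rightarrow> 'v::finite set"
    and \<sigma> :: "'v \<Rightarrow> 'm::comm_quantale"
    and C :: "('v, 'e) com"
  assumes "range \<sigma> \<subseteq> M1"
  shows "alg fv C 1 \<sigma> = alpha \<sigma> \<circ> Delta fv C \<and>
    (\<forall>W :: 'v set. Inf {(\<Prod>w\<in>W. \<Gamma>' w) | \<Gamma>'. typing fv 1 \<sigma> C \<Gamma>'} = alpha \<sigma> (J fv C W))"
proof -
  interpret quantale_hom "alpha \<sigma>"
    by (rule quantale_hom_alpha[OF assms])
  \<comment> \<open>This is \<open>hom_alg\<close> at the symbolic environment \<open>gen\<close>,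
    which evaluation sends to \<open>\<sigma>\<close>.\<close>
  have alg: "alg fv C 1 \<sigma> = alpha \<sigma> \<circ> Delta fv C"
    by (simp add: Delta_def hom_alg hom_one alpha_gen[OF assms])
  then show ?thesis
    by (simp add: Inf_typing_prod[OF one_in_M1 assms] J_def hom_prod)
qed

end
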